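(* For $t>0$ and $m\in\mathbb{Z}^{+}$ let $f(m)=t\ln\left(1+\frac{m}{t}\right)$. Let $\sigma\ge 0$. Then $$\sum_{m=1}^{[t]}\frac{1}{m^{\sigma}}e^{if(m)}=O(1),\qquad t\to\infty.$$
   Context: $[A]$ denotes the integer part of $A$. The parameter $\sigma$ is fixed, and the $O$-statement is for real $t\to\infty$ (the implied constant may depend on $\sigma$). *)

theory Defs
  imports Complex_Main "HOL-Library.Landau_Symbols"
begin

definition phase :: "real \<Rightarrow> nat \<Rightarrow> real" where
  "phase t m = t * ln (1 + real m / t)"

end

theory Submission
  imports Defs "HOL-Analysis.Complex_Transcendental"
begin

text \<open>
  The Kuzmin--Landau argument. The increments of the phase,
  \<open>d m = phase t (m + 1) - phase t m = t * ln (1 + 1 / (t + m))\<close>, decrease with \<open>m\<close> and stay in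
  \<open>[1/3, 1]\<close> for \<open>m \<le> t\<close>, so \<open>cis (d m) - 1\<close> is bounded away from \<open>0\<close>. Hence every term
  \<open>cis (phase t m)\<close> is \<open>1 / (cis (d m) - 1)\<close> times a difference of consecutive terms, and summation
  by parts bounds the sum by the total variation of the coefficients \<open>m powr -\<sigma> / (cis (d m) - 1)\<close>,
  which is bounded because \<open>m powr -\<sigma>\<close> and \<open>d m\<close> are both monotone and bounded.
\<close>

text \<open>A chord of the unit circle is no longer than its arc: with \<open>cis y\<close> factored
  out, the norm is twice the absolute sine of half the angle difference.\<close>

lemma norm_cis_diff_le: "norm (cis x - cis y) \<le> \<bar>x - y\<bar>"
proof -
  have "cis x - cis y = cis y * (exp (\<i> * of_real (x - y)) - 1)"
    by (simp add: cis_conv_exp ring_distribs flip: exp_add)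
  then have "norm (cis x - cis y) = 2 * \<bar>sin ((x - y) / 2)\<bar>"
    using dist_exp_i_1[of "x - y"] by (simp add: norm_mult)
  also have "\<dots> \<le> \<bar>x - y\<bar>"
    using abs_sin_x_le_abs_x[of "(x - y) / 2"] by simp
  finally show ?thesis .
qed

text \<open>Over a common denominator only a chord remains on top. This Lipschitz bound turns the
  variation of the summation-by-parts coefficients into that of the increments \<open>d\<close>,
  which telescopes.\<close>

lemma norm_inverse_cis_minus_1_diff_le:
  assumes "K > 0" "norm (cis x - 1) \<ge> K" "norm (cis y - 1) \<ge> K"
  shows "norm (1 / (cis x - 1) - 1 / (cis y - 1)) \<le> \<bar>x - y\<bar> / K\<^sup>2"
proof -
  have nz: "cis x - 1 \<noteq> 0" "cis y - 1 \<noteq> 0"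
    using assms by auto
  then have "1 / (cis x - 1) - 1 / (cis y - 1) = (cis y - cis x) / ((cis x - 1) * (cis y - 1))"
    by (simp add: divide_simps)
  then have "norm (1 / (cis x - 1) - 1 / (cis y - 1))
      = norm (cis y - cis x) / (norm (cis x - 1) * norm (cis y - 1))"
    by (simp add: norm_divide norm_mult)
  also have "\<dots> \<le> \<bar>x - y\<bar> / (K * K)"
    using assms norm_cis_diff_le[of y x]
    by (intro frac_le mult_mono) (auto simp: abs_minus_commute)
  finally show ?thesis by (simp add: power2_eq_square)
qed

text \<open>The two boundary terms and the variation of \<open>w\<close> contribute
  \<open>w 1 / K\<close>, \<open>w N / K\<close> and \<open>(w 1 - w N) / K\<close>, together
  \<open>2 * w 1 / K\<close>; the last summand comes from the variation of \<open>d\<close>.\<close>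

lemma weighted_Kuzmin_Landau:
  fixes \<theta> w :: "nat \<Rightarrow> real" and K :: real
  defines "d \<equiv> \<lambda>m. \<theta> (Suc m) - \<theta> m"
  assumes "N \<ge> 1" and K: "K > 0"
    and lower: "\<And>m. 1 \<le> m \<Longrightarrow> m \<le> N \<Longrightarrow> norm (cis (d m) - 1) \<ge> K"
    and d_dec: "\<And>m. 1 \<le> m \<Longrightarrow> m < N \<Longrightarrow> d (Suc m) \<le> d m"
    and w_dec: "\<And>m. 1 \<le> m \<Longrightarrow> m < N \<Longrightarrow> w (Suc m) \<le> w m"
    and w_nonneg: "\<And>m. 1 \<le> m \<Longrightarrow> m \<le> N \<Longrightarrow> 0 \<le> w m"
  shows "norm (\<Sum>m=1..N. of_real (w m) * cis (\<theta> m)) \<le> 2 * w 1 / K + w 1 * (d 1 - d N) / K\<^sup>2"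
proof -
  define c where "c m = 1 / (cis (d m) - 1)" for m
  define a where "a m = of_real (w m) * c m" for m
  define S where "S n = (\<Sum>m=1..n. of_real (w m) * cis (\<theta> m))" for n
  have c_bound: "norm (c m) \<le> 1 / K" if "1 \<le> m" "m \<le> N" for m
    using lower[OF that] K by (auto simp: c_def norm_divide intro!: frac_le)
  have by_parts: "of_real (w m) * cis (\<theta> m) = a m * cis (\<theta> (Suc m)) - a m * cis (\<theta> m)"
    if "1 \<le> m" "m \<le> N" for m
  proof -
    have "c m * (cis (d m) - 1) = 1"
      using lower[OF that] K by (auto simp: c_def)
    then have "of_real (w m) * cis (\<theta> m) = a m * (cis (d m) * cis (\<theta> m) - cis (\<theta> m))"
      unfolding a_def by algebra
    also have "cis (d m) * cis (\<theta> m) = cis (\<theta> (Suc m))"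
      by (simp add: d_def cis_mult)
    finally show ?thesis
      by (simp add: right_diff_distrib)
  qed
  have w_le: "w m \<le> w 1" if "1 \<le> m" "m \<le> N" for m
    using that
  proof (induction m rule: nat_induct_at_least)
    case (Suc m)
    then show ?case using w_dec[of m] by simp
  qed simp
  \<comment> \<open>With the right boundary term removed, passing from \<open>n\<close> to
    \<open>Suc n\<close> adds only \<open>a n - a (Suc n)\<close> times a unit number, so the
    induction collects exactly the variation of \<open>a\<close>.\<close>
  have partial: "norm (S n - a n * cis (\<theta> (Suc n)))
      \<le> w 1 / K + (w 1 - w n) / K + w 1 * (d 1 - d n) / K\<^sup>2" if "1 \<le> n" "n \<le> N" for n
    using that
  proof (induction n rule: nat_induct_at_least)
    case base
    have "S 1 - a 1 * cis (\<theta> (Suc 1)) = - (a 1 * cis (\<theta> 1))"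
      using by_parts[of 1] \<open>N \<ge> 1\<close> by (simp add: S_def)
    then have "norm (S 1 - a 1 * cis (\<theta> (Suc 1))) = w 1 * norm (c 1)"
      using w_nonneg[of 1] \<open>N \<ge> 1\<close> by (simp add: a_def norm_mult)
    also have "\<dots> \<le> w 1 / K"
      using mult_left_mono[OF c_bound[of 1] w_nonneg[of 1]] \<open>N \<ge> 1\<close> by simp
    finally show ?case by simp
  next
    case (Suc n)
    then have n: "1 \<le> n" "n < N" by auto
    have "S (Suc n) - a (Suc n) * cis (\<theta> (Suc (Suc n)))
        = (S n - a n * cis (\<theta> (Suc n))) + (a n - a (Suc n)) * cis (\<theta> (Suc n))"
      using by_parts[of "Suc n"] n by (simp add: S_def algebra_simps)
    then have step: "norm (S (Suc n) - a (Suc n) * cis (\<theta> (Suc (Suc n))))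
        \<le> norm (S n - a n * cis (\<theta> (Suc n))) + norm (a n - a (Suc n))"
      using norm_triangle_ineq[of "S n - a n * cis (\<theta> (Suc n))" "(a n - a (Suc n)) * cis (\<theta> (Suc n))"]
      by (simp add: norm_mult)
    \<comment> \<open>Discrete product rule, separating the variation of \<open>w\<close> from that
      of \<open>c\<close>.\<close>
    have "a n - a (Suc n) = of_real (w n - w (Suc n)) * c (Suc n) + of_real (w n) * (c n - c (Suc n))"
      by (simp add: a_def algebra_simps)
    then have "norm (a n - a (Suc n))
        \<le> (w n - w (Suc n)) * norm (c (Suc n)) + w n * norm (c n - c (Suc n))"
      using norm_triangle_ineq[of "of_real (w n - w (Suc n)) * c (Suc n)" "of_real (w n) * (c n - c (Suc n))"]
        w_dec[OF n] w_nonneg[of n] n by (simp add: norm_mult flip: of_real_diff)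
    also have "\<dots> \<le> (w n - w (Suc n)) * (1 / K) + w 1 * ((d n - d (Suc n)) / K\<^sup>2)"
    proof (intro add_mono mult_mono)
      show "norm (c n - c (Suc n)) \<le> (d n - d (Suc n)) / K\<^sup>2"
        using norm_inverse_cis_minus_1_diff_le[OF K lower[of n] lower[of "Suc n"]] d_dec[OF n] n
        by (simp add: c_def)
    qed (use n w_dec w_le w_nonneg[of 1] c_bound[of "Suc n"] in auto)
    finally show ?case
      using step Suc n by (simp add: diff_divide_distrib right_diff_distrib)
  qed
  have "norm (a N * cis (\<theta> (Suc N))) = w N * norm (c N)"
    using w_nonneg[of N] \<open>N \<ge> 1\<close> by (simp add: a_def norm_mult)
  also have "\<dots> \<le> w N / K"
    using mult_left_mono[OF c_bound[of N] w_nonneg[of N]] \<open>N \<ge> 1\<close> by simp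
  finally have "norm (S N) \<le> w 1 / K + (w 1 - w N) / K + w 1 * (d 1 - d N) / K\<^sup>2 + w N / K"
    using partial[of N] \<open>N \<ge> 1\<close>
      norm_triangle_ineq[of "S N - a N * cis (\<theta> (Suc N))" "a N * cis (\<theta> (Suc N))"] by simp
  then show ?thesis
    by (simp add: S_def diff_divide_distrib)
qed

text \<open>Merging the two logarithms leaves a single one, from which monotonicity in
  \<open>m\<close> and both bounds on the increments are read off.\<close>

lemma phase_Suc_diff:
  assumes "t > 0"
  shows "phase t (Suc m) - phase t m = t * ln (1 + 1 / (t + real m))"
proof -
  have pos: "0 < 1 + real k / t" for k
    using assms by (simp add: add_pos_nonneg)
  have "phase t (Suc m) - phase t m = t * ln ((1 + real (Suc m) / t) / (1 + real m / t))"
    unfolding phase_def using pos[of "Suc m"] pos[of m]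
    by (subst ln_divide_pos) (auto simp: right_diff_distrib)
  also have "(1 + real (Suc m) / t) / (1 + real m / t) = 1 + 1 / (t + real m)"
  proof -
    have "1 + real k / t = (t + real k) / t" for k
      using assms by (simp add: field_simps)
    moreover have "t + real m > 0"
      using assms by simp
    ultimately show ?thesis
      using assms by (simp add: divide_simps)
  qed
  finally show ?thesis .
qed

lemma phase_Suc_diff_antimono:
  assumes "t > 0" "m \<le> n"
  shows "phase t (Suc n) - phase t n \<le> phase t (Suc m) - phase t m"
  unfolding phase_Suc_diff[OF assms(1)] using assms
  by (intro mult_left_mono ln_mono add_left_mono divide_left_mono) (auto intro!: add_pos_nonneg)

lemma phase_Suc_diff_le_1:
  assumes "t > 0"
  shows "phase t (Suc m) - phase t m \<le> 1"
proof -
  have "t * ln (1 + 1 / (t + real m)) \<le> t * (1 / (t + real m))"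
    using assms by (intro mult_left_mono ln_add_one_self_le_self) auto
  also have "\<dots> \<le> 1"
    using assms by simp
  finally show ?thesis by (simp add: phase_Suc_diff[OF assms])
qed

text \<open>Applying \<open>ln y \<le> y - 1\<close> to the reciprocal bounds the increment below by
  \<open>t / (t + m + 1)\<close>. This is at least \<open>t / (2 * t + 1)\<close>, hence at least
  \<open>1 / 3\<close> once \<open>t \<ge> 1\<close>.\<close>

lemma phase_Suc_diff_ge:
  assumes "t \<ge> 1" "real m \<le> t"
  shows "phase t (Suc m) - phase t m \<ge> 1 / 3"
proof -
  have "1 / (t + real m + 1) \<le> ln (1 + 1 / (t + real m))"
  proof -
    have "ln (inverse (1 + 1 / (t + real m))) \<le> inverse (1 + 1 / (t + real m)) - 1"
      using assms by (intro ln_le_minus_one) (auto intro!: add_pos_nonneg)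
    also have "\<dots> = - (1 / (t + real m + 1))"
      using assms by (simp add: field_simps)
    finally show ?thesis
      using assms by (simp add: ln_inverse add_pos_nonneg)
  qed
  then have "t * (1 / (t + real m + 1)) \<le> phase t (Suc m) - phase t m"
    using assms by (simp only: phase_Suc_diff) (intro mult_left_mono, auto)
  moreover have "1 / 3 \<le> t * (1 / (t + real m + 1))"
    using assms by (simp add: field_simps)
  ultimately show ?thesis by linarith
qed

theorem lemma2p3:
  fixes \<sigma> :: real
  assumes "\<sigma> \<ge> 0"
  shows "(\<lambda>t::real. \<Sum>m=1..nat \<lfloor>t\<rfloor>.
            complex_of_real (1 / real m powr \<sigma>) * exp (\<i> * complex_of_real (phase t m)))
         \<in> O[at_top](\<lambda>_. 1)"
proof -
  \<comment> \<open>Sine increases on \<open>[1/3, 1]\<close>, where the increments lie, so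
    \<open>sin (1 / 3)\<close> bounds the imaginary part of \<open>cis (d m) - 1\<close>, and hence
    its norm, from below.\<close>
  define K :: real where "K = sin (1 / 3)"
  have K: "K > 0"
    unfolding K_def using pi_gt3 by (intro sin_gt_zero) auto
  have "norm (\<Sum>m=1..nat \<lfloor>t\<rfloor>.
            complex_of_real (1 / real m powr \<sigma>) * exp (\<i> * complex_of_real (phase t m)))
          \<le> 2 / K + 1 / K\<^sup>2" if t: "t \<ge> 1" for t :: real
  proof -
    let ?N = "nat \<lfloor>t\<rfloor>" and ?d = "\<lambda>m. phase t (Suc m) - phase t m"
    have N: "?N \<ge> 1" and le_t: "real m \<le> t" if "m \<le> ?N" for m
      using t that by linarith+
    have "norm (\<Sum>m=1..?N. of_real (1 / real m powr \<sigma>) * cis (phase t m))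
        \<le> 2 * (1 / real 1 powr \<sigma>) / K + (1 / real 1 powr \<sigma>) * (?d 1 - ?d ?N) / K\<^sup>2"
    proof (rule weighted_Kuzmin_Landau)
      fix m assume m: "1 \<le> m" "m \<le> ?N"
      have "K \<le> sin (?d m)"
        unfolding K_def using phase_Suc_diff_ge[OF t le_t[OF m(2)]] phase_Suc_diff_le_1[of t m] t pi_gt3
        by (intro sin_monotone_2pi_le) auto
      also have "\<dots> = Im (cis (?d m) - 1)" by simp
      also have "\<dots> \<le> norm (cis (?d m) - 1)"
        using abs_Im_le_cmod[of "cis (?d m) - 1"] by linarith
      finally show "K \<le> norm (cis (?d m) - 1)" .
    next
      fix m :: nat assume "1 \<le> m"
      then show "1 / real (Suc m) powr \<sigma> \<le> 1 / real m powr \<sigma>"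
        using assms by (intro divide_left_mono powr_mono2) auto
    qed (use N K t phase_Suc_diff_antimono[of t] in auto)
    \<comment> \<open>The first weight is 1 for every \<open>\<sigma>\<close>, and two increments in
      \<open>[1/3, 1]\<close> differ by less than 1, so the bound depends on neither
      \<open>t\<close> nor \<open>\<sigma>\<close>.\<close>
    also have "\<dots> \<le> 2 / K + 1 / K\<^sup>2"
      using phase_Suc_diff_ge[OF t le_t[OF order_refl]] phase_Suc_diff_le_1[of t 1] t
      by (auto intro!: divide_right_mono)
    finally show ?thesis by (simp add: cis_conv_exp)
  qed
  then show ?thesis
    by (intro bigoI[of _ "2 / K + 1 / K\<^sup>2"] eventually_at_top_linorderI[of 1]) simp
qed

end
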